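(* Let $p$ be prime and let $g\in\mathbb{C}^{\mathbb{Z}_p}\setminus\{0\}$ be such that (i) $\|f\|_0+\|V_gf\|_0\ge p^2+1$ for all $f\in\mathbb{C}^{\mathbb{Z}_p}\setminus\{0\}$, and (ii) for all $1\le k\le p$, $1\le l\le p^2$ with $k+l\ge p^2+1$ there is $f\in\mathbb{C}^{\mathbb{Z}_p}$ with $\|f\|_0=k$ and $\|V_gf\|_0=l$. Let $\Lambda\subset\mathbb{Z}_p\times\widehat{\mathbb{Z}_p}$. Then any $f\in\mathbb{C}^{\mathbb{Z}_p}$ with $\|f\|_0\le\tfrac12|\Lambda|$ is uniquely determined by $\Lambda$ and the restriction of $V_gf$ to $\Lambda$; that is, if $f,f'\in\mathbb{C}^{\mathbb{Z}_p}$ satisfy $\|f\|_0,\|f'\|_0\le\tfrac12|\Lambda|$ and $V_gf(\lambda)=V_gf'(\lambda)$ for all $\lambda\in\Lambda$, then $f=f'$.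
   Context: For a finite set $A$, $\mathbb{C}^A$ is the space of functions $f:A\to\mathbb{C}$, and $\|f\|_0=|\{a\in A: f(a)\ne 0\}|$. $\widehat{\mathbb{Z}_p}$ is the dual group of the cyclic group $\mathbb{Z}_p$ (homomorphisms $\xi:\mathbb{Z}_p\to\{z\in\mathbb{C}:|z|=1\}$, $\langle\xi,x\rangle=\xi(x)$). The short-time Fourier transform of $f$ with respect to the window $g\neq0$ is $V_gf(x,\xi)=\sum_{y\in\mathbb{Z}_p}f(y)\,\overline{g(y-x)}\,\overline{\langle\xi,y\rangle}$, $(x,\xi)\in\mathbb{Z}_p\times\widehat{\mathbb{Z}_p}$. *)

theory Defs
  imports Complex_Main "HOL-Computational_Algebra.Primes" "HOL-Algebra.Elementary_Groups"
begin

text \<open>For p > 0 the carrier is \<open>{0..<int p}\<close>; the operation, written multiplicatively, is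
  addition modulo p.\<close>
abbreviation Zmod :: "nat \<Rightarrow> int monoid" where
  "Zmod p \<equiv> integer_mod_group p"

text \<open>
  The space of functions from A to the complex numbers, as extensional functions, so that equality
  of its elements is pointwise equality on A.
\<close>
definition cfuns :: "'a set \<Rightarrow> ('a \<Rightarrow> complex) set" where
  "cfuns A = A \<rightarrow>\<^sub>E UNIV"

definition zero_fun :: "'a set \<Rightarrow> 'a \<Rightarrow> complex" where
  "zero_fun A = (\<lambda>a\<in>A. 0)"

definition l0norm :: "'a set \<Rightarrow> ('a \<Rightarrow> complex) \<Rightarrow> nat" where
  "l0norm A f = card {a \<in> A. f a \<noteq> 0}"

definition circle_group :: "complex monoid" where
  "circle_group = \<lparr>carrier = {z. norm z = 1}, mult = (*), one = 1\<rparr>"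

text \<open>
  \<^const>\<open>hom\<close> does not constrain values outside the carrier; extensionality makes each
  character a single element, so that cardinalities are the right ones.
\<close>
definition dual_group :: "('a, 'b) monoid_scheme \<Rightarrow> ('a \<Rightarrow> complex) set" where
  "dual_group G = hom G circle_group \<inter> extensional (carrier G)"

definition phase_space :: "('a, 'b) monoid_scheme \<Rightarrow> ('a \<times> ('a \<Rightarrow> complex)) set" where
  "phase_space G = carrier G \<times> dual_group G"

definition stft ::
  "('a, 'b) monoid_scheme \<Rightarrow> ('a \<Rightarrow> complex) \<Rightarrow> ('a \<Rightarrow> complex) \<Rightarrow> 'a \<times> ('a \<Rightarrow> complex) \<Rightarrow> complex"
where
  "stft G g f = (\<lambda>(x, \<xi>)\<in>phase_space G.
     \<Sum>y\<in>carrier G. f y * cnj (g (y \<otimes>\<^bsub>G\<^esub> inv\<^bsub>G\<^esub> x)) * cnj (\<xi> y))"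

end

theory Submission
  imports Defs
begin

text \<open>
  By linearity, \<open>h = f - f'\<close> has a short-time Fourier transform that vanishes on \<open>\<Lambda>\<close>
  (\<open>stft_diff\<close>), and the support of \<open>h\<close> is contained in the union of those of \<open>f\<close> and \<open>f'\<close>, so
  it has at most \<open>card \<Lambda>\<close> elements (\<open>l0norm_diff_le\<close>). The cyclic group of order \<open>p\<close> has at most
  \<open>p\<close> characters, since a character is determined by its value at the generator, which is a
  \<open>p\<close>-th root of unity; hence the phase space is finite with at most \<open>p\<^sup>2\<close> points
  (\<open>phase_space_Zmod\<close>) and the transform of \<open>h\<close> has at most \<open>p\<^sup>2 - card \<Lambda>\<close> nonzero values. The
  two supports thus have total size at most \<open>p\<^sup>2\<close>, and the assumed uncertainty
  inequality forces \<open>h = 0\<close>.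
\<close>

lemma character_Zmod_mod:
  assumes "p > 0" and \<xi>: "\<xi> \<in> dual_group (Zmod p)"
  shows "\<xi> (int k mod int p) = \<xi> (1 mod int p) ^ k"
proof (induction k)
  have mult: "\<xi> ((x + y) mod int p) = \<xi> x * \<xi> y" if "x \<in> {0..<int p}" "y \<in> {0..<int p}" for x y
    using \<xi> that assms(1)
    by (auto simp: dual_group_def hom_def circle_group_def carrier_integer_mod_group
        mult_integer_mod_group)
  {
    case 0
    have "norm (\<xi> 0) = 1"
      using \<xi> assms(1)
      by (auto simp: dual_group_def hom_def circle_group_def carrier_integer_mod_group Pi_iff)
    then have "\<xi> 0 \<noteq> 0" by auto
    moreover have "\<xi> 0 = \<xi> 0 * \<xi> 0" using mult[of 0 0] assms(1) by simp
    ultimately show ?case by simp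
  next
    case (Suc k)
    have "int (Suc k) mod int p = (int k mod int p + 1 mod int p) mod int p"
      by (simp add: mod_simps add.commute)
    then show ?case
      using mult[of "int k mod int p" "1 mod int p"] assms(1) Suc by (simp add: mult.commute)
  }
qed

lemma dual_group_Zmod:
  assumes "p > 0"
  shows "finite (dual_group (Zmod p))" "card (dual_group (Zmod p)) \<le> p"
proof -
  let ?D = "dual_group (Zmod p)" and ?R = "{z::complex. z ^ p = 1}"
  let ?ev = "\<lambda>\<xi>::int \<Rightarrow> complex. \<xi> (1 mod int p)"
  have inj: "inj_on ?ev ?D"
  proof (rule inj_onI)
    fix \<xi> \<eta> assume "\<xi> \<in> ?D" "\<eta> \<in> ?D" and eq: "\<xi> (1 mod int p) = \<eta> (1 mod int p)"
    have "\<xi> x = \<eta> x" if "x \<in> carrier (Zmod p)" for x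
    proof -
      from that assms have "x = int (nat x) mod int p"
        by (auto simp: carrier_integer_mod_group)
      then show ?thesis
        using character_Zmod_mod[OF assms, of _ "nat x"] \<open>\<xi> \<in> ?D\<close> \<open>\<eta> \<in> ?D\<close> eq by metis
    qed
    with \<open>\<xi> \<in> ?D\<close> \<open>\<eta> \<in> ?D\<close> show "\<xi> = \<eta>"
      by (auto simp: dual_group_def intro: extensionalityI)
  qed
  have img: "?ev ` ?D \<subseteq> ?R"
  proof clarify
    fix \<xi> assume \<xi>: "\<xi> \<in> ?D"
    show "\<xi> (1 mod int p) ^ p = 1"
      using character_Zmod_mod[OF assms \<xi>, of p] character_Zmod_mod[OF assms \<xi>, of 0] by simp
  qed
  have fin: "finite ?R" and card: "card ?R \<le> p"
    using finite_roots_unity[of p] card_roots_unity[of p] assms by auto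
  show "finite ?D" using inj_on_finite[OF inj img fin] .
  show "card ?D \<le> p" using card_inj_on_le[OF inj img fin] card by simp
qed

lemma phase_space_Zmod:
  assumes "p > 0"
  shows "finite (phase_space (Zmod p))" "card (phase_space (Zmod p)) \<le> p\<^sup>2"
  using dual_group_Zmod[OF assms] assms
  by (auto simp: phase_space_def carrier_integer_mod_group card_cartesian_product power2_eq_square)

lemma stft_diff:
  assumes "z \<in> phase_space G"
  shows "stft G g (\<lambda>a\<in>carrier G. f a - f' a) z = stft G g f z - stft G g f' z"
  using assms
  by (cases z) (simp add: stft_def sum_subtractf [symmetric] left_diff_distrib cong: sum.cong)

lemma l0norm_diff_le:
  assumes "finite A"
  shows "l0norm A (\<lambda>a\<in>A. f a - f' a) \<le> l0norm A f + l0norm A f'"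
proof -
  have "l0norm A (\<lambda>a\<in>A. f a - f' a) \<le> card ({a \<in> A. f a \<noteq> 0} \<union> {a \<in> A. f' a \<noteq> 0})"
    unfolding l0norm_def using assms by (intro card_mono) auto
  then show ?thesis
    unfolding l0norm_def using card_Un_le order_trans by blast
qed

lemma l0norm_le_card_diff:
  assumes "finite A" "B \<subseteq> A" "\<And>b. b \<in> B \<Longrightarrow> f b = 0"
  shows "l0norm A f \<le> card A - card B"
proof -
  have "l0norm A f \<le> card (A - B)"
    unfolding l0norm_def using assms by (intro card_mono) auto
  then show ?thesis
    using assms by (simp add: card_Diff_subset finite_subset)
qed

theorem theorem5p7:
  fixes p :: nat and g :: "int \<Rightarrow> complex"
    and \<Lambda> :: "(int \<times> (int \<Rightarrow> complex)) set"
  assumes "prime p"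
    and "g \<in> cfuns (carrier (Zmod p)) - {zero_fun (carrier (Zmod p))}"
    and "\<And>f. f \<in> cfuns (carrier (Zmod p)) - {zero_fun (carrier (Zmod p))} \<Longrightarrow>
           l0norm (carrier (Zmod p)) f + l0norm (phase_space (Zmod p)) (stft (Zmod p) g f) \<ge> p^2 + 1"
    and "\<And>k l :: nat. \<lbrakk>1 \<le> k; k \<le> p; 1 \<le> l; l \<le> p^2; k + l \<ge> p^2 + 1\<rbrakk> \<Longrightarrow>
           \<exists>f \<in> cfuns (carrier (Zmod p)).
             l0norm (carrier (Zmod p)) f = k \<and> l0norm (phase_space (Zmod p)) (stft (Zmod p) g f) = l"
    and "\<Lambda> \<subseteq> phase_space (Zmod p)"
  shows "\<forall>f \<in> cfuns (carrier (Zmod p)). \<forall>f' \<in> cfuns (carrier (Zmod p)).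
           real (l0norm (carrier (Zmod p)) f) \<le> 1/2 * real (card \<Lambda>) \<longrightarrow>
           real (l0norm (carrier (Zmod p)) f') \<le> 1/2 * real (card \<Lambda>) \<longrightarrow>
           (\<forall>z \<in> \<Lambda>. stft (Zmod p) g f z = stft (Zmod p) g f' z) \<longrightarrow>
           f = f'"
proof (intro ballI impI)
  let ?A = "carrier (Zmod p)" and ?P = "phase_space (Zmod p)"
  fix f f'
  assume f: "f \<in> cfuns ?A" and f': "f' \<in> cfuns ?A"
    and nf: "real (l0norm ?A f) \<le> 1/2 * real (card \<Lambda>)"
    and nf': "real (l0norm ?A f') \<le> 1/2 * real (card \<Lambda>)"
    and eq: "\<forall>z \<in> \<Lambda>. stft (Zmod p) g f z = stft (Zmod p) g f' z"
  have p: "p > 0" using assms(1) by (simp add: prime_gt_0_nat)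
  define h where "h = (\<lambda>a\<in>?A. f a - f' a)"
  have "l0norm ?A h \<le> l0norm ?A f + l0norm ?A f'"
    unfolding h_def using p by (intro l0norm_diff_le) (simp add: carrier_integer_mod_group)
  then have small: "l0norm ?A h \<le> card \<Lambda>" using nf nf' by linarith
  have "l0norm ?P (stft (Zmod p) g h) \<le> card ?P - card \<Lambda>"
    using phase_space_Zmod(1)[OF p] assms(5) eq
    by (intro l0norm_le_card_diff) (auto simp: h_def stft_diff)
  moreover have "card \<Lambda> \<le> card ?P"
    using phase_space_Zmod(1)[OF p] assms(5) by (rule card_mono)
  ultimately have "l0norm ?A h + l0norm ?P (stft (Zmod p) g h) < p^2 + 1"
    using small phase_space_Zmod(2)[OF p] by linarith
  then have "h \<notin> cfuns ?A - {zero_fun ?A}" using assms(3)[of h] by linarith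
  then have "h = zero_fun ?A" by (auto simp: h_def cfuns_def)
  then have "f a - f' a = 0" if "a \<in> ?A" for a
  proof -
    have "h a = zero_fun ?A a" using \<open>h = zero_fun ?A\<close> by simp
    then show ?thesis using that by (simp add: h_def zero_fun_def)
  qed
  then show "f = f'"
    using f f' unfolding cfuns_def by (intro PiE_ext[of f ?A _ f']) auto
qed

end
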